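(* Let $\tau\in\mathbb T$ be a periodic point of the doubling map $D(x)=2x \bmod 1$. Then there exists a tongue all of whose elements are parameters of type $\tau$.
   Context: Let $\mathbb T=\mathbb R/\mathbb Z$, identified with $[0,1]$ with $0\sim 1$. For $(a,b)\in\mathbb R/\mathbb Z\times[0,1]$ define $f_{a,b}:\mathbb T\to\mathbb T$ by $f_{a,b}(x)=\left(2x+a+\frac b2 S(x)\right)\bmod 1$, where $S(x)=4x-1$ for $x\in[0,\frac12]$ and $S(x)=-4x+3$ for $x\in[\frac12,1)$. Write $I_+=[0,\frac12]$, $I_-=[\frac12,1]$. Itineraries: for a periodic orbit $x_0,\dots,x_{p-1}$ of exact period $p$ avoiding $0$ and $\frac12$, its periodic slope itinerary is $\sigma=(\sigma_0,\dots,\sigma_{p-1})\in\{-,+\}^p$ with $x_j\in I_{\sigma_j}$; it is single minus if exactly one $\sigma_j$ is $-$. A periodic cycle of period $p$ is attracting if each of its points has a neighbourhood all of whose points converge to it under iteration of $f_{a,b}^p$. A connected component $S$ of the set of parameters $(a,b)$ corresponding to attracting cycles with periodic slope itinerary $\sigma$ is called a tongue if $\overline S$ intersects $\mathbb T\times\{1\}$ in a nontrivial interval. Semiconjugacy: let $F_{a,b}:\mathbb R\to\mathbb R$ be the continuous lift of $f_{a,b}$ with $F_{a,b}(0)\in[0,1)$; it satisfies $F_{a,b}(x+k)=F_{a,b}(x)+2k$ for $k\in\mathbb Z$. The limit $\Phi_{a,b}(x)=\lim_{n\to\infty}F_{a,b}^n(x)/2^n$ exists uniformly in $x$, satisfies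 $\Phi_{a,b}(x+k)=\Phi_{a,b}(x)+k$ for $k\in\mathbb Z$, and is the lift of a map $\phi_{a,b}:\mathbb T\to\mathbb T$ with $\phi_{a,b}\circ f_{a,b}=D\circ\phi_{a,b}$. Type: $f_{a,b}$ has at most one attracting cycle. If $f_{a,b}$ has an attracting cycle $(x_0,\dots,x_{p-1})$ with single minus itinerary and $x_0\in I_-$, then the parameter $(a,b)$ is said to have type $\tau=\phi_{a,b}(x_0)$. *)

theory Defs
  imports "HOL-Analysis.Analysis"
begin

section \<open>The circle\<close>

quotient_type circle = real / "\<lambda>x y. x - y \<in> \<int>"
  morphisms rep_circle to_circle
proof (rule equivpI)
  show "reflp (\<lambda>x y::real. x - y \<in> \<int>)" by (simp add: reflp_def)
  show "symp (\<lambda>x y::real. x - y \<in> \<int>)" by (metis (no_types, lifting) Ints_minus minus_diff_eq sympI)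
  show "transp (\<lambda>x y::real. x - y \<in> \<int>)"
  proof (rule transpI)
    fix x y z :: real assume "x - y \<in> \<int>" "y - z \<in> \<int>"
    then have "(x - y) + (y - z) \<in> \<int>" by (rule Ints_add)
    then show "x - z \<in> \<int>" by simp
  qed
qed

instantiation circle :: topological_space
begin

text \<open>The quotient topology.\<close>

definition open_circle :: "circle set \<Rightarrow> bool"
  where "open_circle U \<longleftrightarrow> open (to_circle -` U)"

instance
proof
  show "open (UNIV :: circle set)" by (simp add: open_circle_def)
  show "open (U \<inter> V)" if "open U" "open V" for U V :: "circle set"
    using that by (simp add: open_circle_def open_Int)
  show "open (\<Union>K)" if "\<forall>U\<in>K. open U" for K :: "circle set set"
    using that by (auto simp: open_circle_def vimage_Union)
qed

end

lemma to_circle_eq_iff: "to_circle x = to_circle y \<longleftrightarrow> x - y \<in> \<int>"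
  by (rule circle.abs_eq_iff)

lift_definition doubling :: "circle \<Rightarrow> circle" is "\<lambda>x. 2 * x"
  by (metis Ints_mult Ints_numeral right_diff_distrib)

section \<open>The family of circle maps\<close>

definition tri :: "real \<Rightarrow> real" where
  "tri t = (if frac t \<le> 1/2 then 4 * frac t - 1 else - 4 * frac t + 3)"

lemma tri_add_Ints: "k \<in> \<int> \<Longrightarrow> tri (t + k) = tri t"
  by (auto simp: tri_def elim!: Ints_cases)

lemma tri_bound: "\<bar>tri t\<bar> \<le> 1"
  using frac_ge_0[of t] frac_lt_1[of t] by (auto simp: tri_def abs_le_iff)

lemma tri_arccos: "tri t = 2 / pi * arccos (cos (2 * pi * t)) - 1"
proof -
  have "cos (2 * pi * t) = cos (2 * pi * frac t + 2 * pi * of_int \<lfloor>t\<rfloor>)"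
    by (simp add: frac_def algebra_simps)
  also have "\<dots> = cos (2 * pi * frac t)"
    by (simp add: cos_add)
  finally have c: "cos (2 * pi * t) = cos (2 * pi * frac t)" .
  show ?thesis
  proof (cases "frac t \<le> 1/2")
    case True
    then have "arccos (cos (2 * pi * frac t)) = 2 * pi * frac t"
      by (intro arccos_cos) auto
    with True c show ?thesis by (simp add: tri_def)
  next
    case False
    have "cos (2 * pi * frac t) = cos (2 * pi * (1 - frac t))"
      by (simp add: algebra_simps cos_diff)
    moreover have "arccos (cos (2 * pi * (1 - frac t))) = 2 * pi * (1 - frac t)"
      using False frac_lt_1[of t] by (intro arccos_cos) auto
    ultimately show ?thesis using False c by (simp add: tri_def field_simps)
  qed
qed

lemma continuous_on_tri: "continuous_on UNIV tri"
proof -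
  have "continuous_on UNIV (\<lambda>t. 2 / pi * arccos (cos (2 * pi * t)) - 1)"
    by (intro continuous_intros) auto
  then show ?thesis by (simp add: tri_arccos[abs_def])
qed

lift_definition fmap :: "circle \<Rightarrow> real \<Rightarrow> circle \<Rightarrow> circle"
  is "\<lambda>a b x. 2 * x + a + b / 2 * tri x"
proof -
  fix a a' b x x' :: real
  assume a: "a - a' \<in> \<int>" and x: "x - x' \<in> \<int>"
  have "tri x = tri x'" using tri_add_Ints[OF x, of x'] by simp
  then have "(2 * x + a + b / 2 * tri x) - (2 * x' + a' + b / 2 * tri x') = 2 * (x - x') + (a - a')"
    by simp
  also have "\<dots> \<in> \<int>" using a x by (intro Ints_add Ints_mult) auto
  finally show "(2 * x + a + b / 2 * tri x) - (2 * x' + a' + b / 2 * tri x') \<in> \<int>" .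
qed

section \<open>The semiconjugacy to the doubling map\<close>

text \<open>The continuous lift of \<open>fmap a b\<close> with value in \<open>[0, 1)\<close> at \<open>0\<close>; it is unique, see
  \<open>is_lift_unique\<close> below.\<close>

definition is_lift :: "circle \<Rightarrow> real \<Rightarrow> (real \<Rightarrow> real) \<Rightarrow> bool" where
  "is_lift a b G \<longleftrightarrow> continuous_on UNIV G
     \<and> (\<forall>x. to_circle (G x) = fmap a b (to_circle x)) \<and> 0 \<le> G 0 \<and> G 0 < 1"

definition Flift :: "circle \<Rightarrow> real \<Rightarrow> real \<Rightarrow> real" where
  "Flift a b = (THE G. is_lift a b G)"

lemma is_lift_explicit:
  "is_lift (to_circle a) b (\<lambda>x. 2 * x + b / 2 * (tri x + 1) + frac (a - b / 2))"
proof -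
  have "to_circle (2 * x + b / 2 * (tri x + 1) + frac (a - b / 2))
      = fmap (to_circle a) b (to_circle x)" for x
  proof -
    have "(2 * x + b / 2 * (tri x + 1) + frac (a - b / 2)) - (2 * x + a + b / 2 * tri x)
        = - of_int \<lfloor>a - b / 2\<rfloor>"
      by (simp add: frac_def field_simps)
    then show ?thesis by (simp add: fmap.abs_eq to_circle_eq_iff)
  qed
  moreover have "tri 0 = -1" by (simp add: tri_def)
  ultimately show ?thesis
    unfolding is_lift_def
    by (auto intro!: continuous_intros continuous_on_tri simp: frac_lt_1)
qed

lemma is_lift_unique:
  assumes G: "is_lift a b G" and H: "is_lift a b H"
  shows "G = H"
proof -
  define h where "h = (\<lambda>x. G x - H x)"
  have int: "h x \<in> \<int>" for x
    using G H by (simp add: is_lift_def h_def flip: to_circle_eq_iff)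
  have "continuous_on UNIV h"
    using G H unfolding h_def is_lift_def by (intro continuous_intros) auto
  then have "h constant_on UNIV"
  proof (rule continuous_discrete_range_constant[OF connected_UNIV])
    fix x :: real
    have "1 \<le> norm (h y - h x)" if "h y \<noteq> h x" for y
      using Ints_nonzero_abs_ge1[of "h y - h x"] int that by auto
    then show "\<exists>e>0. \<forall>y. y \<in> UNIV \<and> h y \<noteq> h x \<longrightarrow> e \<le> norm (h y - h x)"
      by (intro exI[of _ 1]) auto
  qed
  then obtain c where c: "h x = c" for x by (auto simp: constant_on_def)
  have "\<bar>h 0\<bar> < 1" using G H by (auto simp: is_lift_def h_def abs_if)
  with int[of 0] have "h 0 = 0" using Ints_nonzero_abs_ge1[of "h 0"] by auto
  with c have "h x = 0" for x by simp
  then show ?thesis by (auto simp: h_def)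
qed

lemma Flift_explicit:
  "Flift (to_circle a) b = (\<lambda>x. 2 * x + b / 2 * (tri x + 1) + frac (a - b / 2))"
  unfolding Flift_def using is_lift_explicit is_lift_unique by (intro the_equality) blast+

lemma is_lift_Flift: "is_lift a b (Flift a b)"
  by (induction a rule: circle.abs_induct) (simp only: Flift_explicit is_lift_explicit)

definition Phi :: "circle \<Rightarrow> real \<Rightarrow> real \<Rightarrow> real" where
  "Phi a b x = lim (\<lambda>n. (Flift a b ^^ n) x / 2 ^ n)"

lemma Flift_add_Ints:
  assumes "k \<in> \<int>"
  shows "Flift a b (x + k) = Flift a b x + 2 * k"
  using assms
  by (induction a rule: circle.abs_induct) (simp add: Flift_explicit tri_add_Ints)

lemma funpow_Flift_add_Ints:
  assumes "k \<in> \<int>"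
  shows "(Flift a b ^^ n) (x + k) = (Flift a b ^^ n) x + 2 ^ n * k"
proof (induction n)
  case (Suc n)
  have "2 ^ n * k \<in> \<int>" using assms by (intro Ints_mult) auto
  with Suc show ?case by (simp add: Flift_add_Ints)
qed simp

lemma Flift_bound: "\<exists>M. \<forall>x. \<bar>Flift a b x - 2 * x\<bar> \<le> M"
proof (induction a rule: circle.abs_induct)
  case (1 a)
  have "\<bar>Flift (to_circle a) b x - 2 * x\<bar> \<le> \<bar>b\<bar> + 1" for x
  proof -
    have "\<bar>b / 2 * (tri x + 1)\<bar> \<le> \<bar>b\<bar> / 2 * 2"
      unfolding abs_mult using tri_bound[of x] by (intro mult_mono) auto
    moreover have "0 \<le> frac (a - b/2)" "frac (a - b/2) < 1"
      by (auto simp: frac_lt_1)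
    ultimately have "\<bar>b / 2 * (tri x + 1) + frac (a - b/2)\<bar> \<le> \<bar>b\<bar> + 1" by linarith
    then show ?thesis by (simp add: Flift_explicit)
  qed
  then show ?case by blast
qed

lemma Phi_LIMSEQ: "(\<lambda>n. (Flift a b ^^ n) x / 2 ^ n) \<longlonglongrightarrow> Phi a b x"
proof -
  define u where "u = (\<lambda>n. (Flift a b ^^ n) x / 2 ^ n)"
  obtain M where M: "\<bar>Flift a b y - 2 * y\<bar> \<le> M" for y using Flift_bound by blast
  have "summable (\<lambda>n. u (Suc n) - u n)"
  proof (rule summable_comparison_test')
    show "summable (\<lambda>n. M / 2 * (1/2) ^ n)"
      by (intro summable_mult summable_geometric) auto
    fix n :: nat
    have "u (Suc n) - u n = (Flift a b ((Flift a b ^^ n) x) - 2 * (Flift a b ^^ n) x) / (2 * 2 ^ n)"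
      by (simp add: u_def field_simps)
    then have "\<bar>u (Suc n) - u n\<bar> = \<bar>Flift a b ((Flift a b ^^ n) x) - 2 * (Flift a b ^^ n) x\<bar> / (2 * 2 ^ n)"
      by (simp add: abs_divide abs_mult)
    also have "\<dots> \<le> M / (2 * 2 ^ n)" by (intro divide_right_mono M) auto
    finally show "norm (u (Suc n) - u n) \<le> M / 2 * (1/2) ^ n"
      by (simp add: power_divide)
  qed
  then have "convergent (\<lambda>n. \<Sum>i<n. u (Suc i) - u i)"
    by (simp add: summable_iff_convergent)
  then have "convergent (\<lambda>n. (u n - u 0) + u 0)"
    unfolding sum_lessThan_telescope by (intro convergent_add convergent_const)
  then have "convergent u" by simp
  then show ?thesis by (simp add: Phi_def convergent_LIMSEQ_iff u_def)
qed

lemma Phi_add_Ints: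
  assumes "k \<in> \<int>"
  shows "Phi a b (x + k) = Phi a b x + k"
proof -
  have "(\<lambda>n. (Flift a b ^^ n) x / 2 ^ n + k) \<longlonglongrightarrow> Phi a b x + k"
    by (intro tendsto_intros Phi_LIMSEQ)
  then have "(\<lambda>n. (Flift a b ^^ n) (x + k) / 2 ^ n) \<longlonglongrightarrow> Phi a b x + k"
    by (simp add: funpow_Flift_add_Ints[OF assms] add_divide_distrib)
  then show ?thesis using Phi_LIMSEQ LIMSEQ_unique by blast
qed

lift_definition phi :: "circle \<Rightarrow> real \<Rightarrow> circle \<Rightarrow> circle" is Phi
proof -
  fix a b and x x' :: real
  assume "x - x' \<in> \<int>"
  from Phi_add_Ints[OF this, of a b x'] this show "Phi a b x - Phi a b x' \<in> \<int>" by simp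
qed

section \<open>Attracting cycles, itineraries, tongues and types\<close>

definition exact_period :: "('a \<Rightarrow> 'a) \<Rightarrow> nat \<Rightarrow> 'a \<Rightarrow> bool" where
  "exact_period f p x \<longleftrightarrow> p > 0 \<and> (f ^^ p) x = x \<and> (\<forall>j. 0 < j \<and> j < p \<longrightarrow> (f ^^ j) x \<noteq> x)"

text \<open>Cycles are represented by a starting point together with the exact period.\<close>

definition attracting_cycle :: "('a::topological_space \<Rightarrow> 'a) \<Rightarrow> nat \<Rightarrow> 'a \<Rightarrow> bool" where
  "attracting_cycle f p x \<longleftrightarrow> exact_period f p x \<and>
     (\<forall>j<p. \<exists>U. open U \<and> (f ^^ j) x \<in> U \<and>
        (\<forall>y\<in>U. (\<lambda>n. ((f ^^ p) ^^ n) y) \<longlonglongrightarrow> (f ^^ j) x))"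

datatype slope = Minus | Plus

fun slope_interval :: "slope \<Rightarrow> circle set" where
  "slope_interval Plus = to_circle ` {0..1/2}"
| "slope_interval Minus = to_circle ` {1/2..1}"

definition has_itinerary :: "(circle \<Rightarrow> circle) \<Rightarrow> circle \<Rightarrow> slope list \<Rightarrow> bool" where
  "has_itinerary f x \<sigma> \<longleftrightarrow> exact_period f (length \<sigma>) x \<and>
     (\<forall>j<length \<sigma>. (f ^^ j) x \<notin> {to_circle 0, to_circle (1/2)} \<and>
        (f ^^ j) x \<in> slope_interval (\<sigma> ! j))"

definition single_minus :: "slope list \<Rightarrow> bool" where
  "single_minus \<sigma> \<longleftrightarrow> count_list \<sigma> Minus = 1"

definition itinerary_params :: "slope list \<Rightarrow> (circle \<times> real) set" where
  "itinerary_params \<sigma> = {(a, b). 0 \<le> b \<and> b \<le> 1 \<and>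
     (\<exists>x. attracting_cycle (fmap a b) (length \<sigma>) x \<and> has_itinerary (fmap a b) x \<sigma>)}"

text \<open>A nontrivial interval of the circle is a compact arc that is neither a point nor the
  whole circle; the arc is necessarily compact here, since it is cut out by a closed set.\<close>

definition tongue :: "(circle \<times> real) set \<Rightarrow> bool" where
  "tongue S \<longleftrightarrow> (\<exists>\<sigma>. S \<in> components (itinerary_params \<sigma>)) \<and>
     (\<exists>c d. c < d \<and> d < c + 1 \<and>
        closure S \<inter> (UNIV \<times> {1}) = to_circle ` {c..d} \<times> {1})"

text \<open>\<open>fmap a b\<close> has at most one attracting cycle, so a parameter has at most one type; not
  every parameter has one, hence the type is expressed as a relation.\<close>

definition has_type :: "circle \<Rightarrow> real \<Rightarrow> circle \<Rightarrow> bool" where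
  "has_type a b \<tau> \<longleftrightarrow> (\<exists>\<sigma> x. attracting_cycle (fmap a b) (length \<sigma>) x \<and>
     has_itinerary (fmap a b) x \<sigma> \<and> single_minus \<sigma> \<and>
     x \<in> slope_interval Minus \<and> phi a b x = \<tau>)"

end

theory Submission
  imports Defs
begin

text \<open>
  Let \<open>p\<close> be the exact period of \<open>\<tau>\<close> under doubling. A lift of \<open>\<tau>\<close> has the form
  \<open>m / (2 ^ p - 1)\<close> with \<open>m\<close> an integer. The tongue is found inside the set \<open>P\<close> of parameters with
  an attracting cycle of itinerary \<open>-+...+\<close> of length \<open>p\<close>. Let \<open>F\<close> be a lift of the map. If \<open>x\<close> in
  \<open>(1/2, 1)\<close> lies over the point with sign \<open>-\<close>, then \<open>F ^ p\<close> maps \<open>x\<close> to \<open>x + k\<close> for an integer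
  \<open>k\<close>, and the functional equation of \<open>\<Phi>\<close> gives \<open>\<Phi> x = k / (2 ^ p - 1)\<close>. The type is therefore
  determined by the integer \<open>k\<close> modulo \<open>2 ^ p - 1\<close>.

  The type is locally constant on \<open>P\<close>. Attraction forces the multiplier
  \<open>(2 - 2 b) (2 + 2 b) ^ (p - 1)\<close> of the cycle below one (\<open>multiplier_less_1\<close>). This number also
  bounds the slope of the increasing function \<open>F ^ p\<close> on the whole interval \<open>[1/2, 1]\<close>, whatever the
  later itinerary. Hence moving from \<open>x\<close> back to \<open>1/2\<close> decreases \<open>F ^ p\<close> by at most \<open>x - 1/2\<close>, and
  the level \<open>u = F ^ p (1/2) - 1/2\<close> lies in \<open>[k, k + 1/2]\<close> (\<open>itinerary_level\<close>). These intervals are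
  disjoint for different \<open>k\<close>, and \<open>u\<close> is continuous in the parameters. The condition that \<open>u\<close> lies
  in such an interval with \<open>k\<close> congruent to \<open>m\<close>, and the same condition with \<open>k\<close> not congruent to
  \<open>m\<close>, define two disjoint closed sets, the bands, that cover \<open>P\<close>. A component \<open>S\<close> of \<open>P\<close> that
  meets the first band stays in it, so all of its elements have type \<open>\<tau>\<close>, and its closure
  stays in the band too.

  On the circle \<open>b = 1\<close> the map is constant on \<open>[1/2, 1]\<close>, and \<open>u\<close> is a strictly increasing function
  of \<open>a\<close>. The band of \<open>m\<close> cuts out an arc there, given by \<open>m \<le> u \<le> m + 1/2\<close>. For the interior points
  of the arc, \<open>F ^ p (1/2) - m\<close> lies in \<open>(1/2, 1)\<close> and is superattracting. Its other iterates
  cannot return to \<open>I_-\<close>: the map is constant there, so \<open>\<Phi>\<close> is constant there too, and a return after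
  fewer than \<open>p\<close> steps would give \<open>\<tau>\<close> a smaller period (\<open>superattracting_orbit_Plus\<close>).
  So the open arc lies in \<open>P\<close>. Being connected it lies in a single component \<open>S\<close>, and the closure of \<open>S\<close> meets the circle \<open>b = 1\<close> in
  exactly the closed arc.
\<close>

section \<open>The real lifts\<close>

text \<open>In contrast to \<open>Flift\<close>, this lift depends on a real parameter \<open>a\<close>, and continuously so; it
  differs from \<open>Flift (to_circle a) b\<close> by an integer constant.\<close>

definition F :: "real \<Rightarrow> real \<Rightarrow> real \<Rightarrow> real" where
  "F a b x = 2 * x + a + b / 2 * tri x"

lemma funpow_F_Suc:
  "(F a b ^^ Suc n) x = 2 * (F a b ^^ n) x + a + b / 2 * tri ((F a b ^^ n) x)"
  by (simp add: F_def[of a b "(F a b ^^ n) x"])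

lemma two_power_minus_1_nonzero:
  assumes "0 < p"
  shows "(2::real) ^ p - 1 \<noteq> 0"
proof -
  have "(1::real) < 2 ^ p" using assms by (intro one_less_power) auto
  then show ?thesis by linarith
qed

lemma tri_Plus:
  assumes "of_int k \<le> x" "x \<le> of_int k + 1/2"
  shows "tri x = 4 * (x - of_int k) - 1"
proof -
  have "\<lfloor>x\<rfloor> = k" using assms by linarith
  then have "frac x = x - of_int k" by (simp add: frac_def)
  then show ?thesis using assms by (simp add: tri_def)
qed

lemma tri_Minus:
  assumes "of_int k + 1/2 \<le> x" "x \<le> of_int k + 1"
  shows "tri x = 3 - 4 * (x - of_int k)"
proof (cases "x = of_int k + 1")
  case True
  then show ?thesis using tri_Plus[of "k + 1" x] by simp
next
  case False
  then have "\<lfloor>x\<rfloor> = k" using assms by linarith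
  then have "frac x = x - of_int k" by (simp add: frac_def)
  then show ?thesis using assms by (auto simp: tri_def)
qed

text \<open>\<open>(tri x + 1) / 4\<close> is the distance from \<open>x\<close> to the nearest integer: the next two facts say
  that it is a lower bound for the distances to the integers and that it is attained. This makes
  \<open>tri\<close> Lipschitz without a case distinction on the branches of two different points.\<close>

lemma tri_le: "tri x \<le> 4 * \<bar>x - of_int k\<bar> - 1"
proof -
  define z where "z = x - of_int k"
  have "tri x = tri z" using tri_add_Ints[of "of_int k" z] by (simp add: z_def)
  moreover have "tri z \<le> 4 * \<bar>z\<bar> - 1"
  proof -
    consider "\<bar>z\<bar> \<ge> 1/2" | "0 \<le> z" "z \<le> 1/2" | "-1/2 \<le> z" "z \<le> 0" by linarith
    then show ?thesis
    proof cases
      case 1 then show ?thesis using tri_bound[of z] by linarith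
    next
      case 2 then show ?thesis using tri_Plus[of 0 z] by simp
    next
      case 3 then show ?thesis using tri_Minus[of "-1" z] by simp
    qed
  qed
  ultimately show ?thesis by (simp add: z_def)
qed

lemma tri_attained: "\<exists>k::int. \<bar>x - of_int k\<bar> \<le> 1/2 \<and> tri x = 4 * \<bar>x - of_int k\<bar> - 1"
proof (cases "x \<le> of_int \<lfloor>x\<rfloor> + 1/2")
  case True
  then show ?thesis using tri_Plus[of "\<lfloor>x\<rfloor>" x] by (intro exI[of _ "\<lfloor>x\<rfloor>"]) auto
next
  case False
  moreover have "x \<le> of_int \<lfloor>x\<rfloor> + 1" by linarith
  ultimately show ?thesis using tri_Minus[of "\<lfloor>x\<rfloor>" x]
    by (intro exI[of _ "\<lfloor>x\<rfloor> + 1"]) (auto simp: abs_if)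
qed

lemma tri_lipschitz: "\<bar>tri y - tri x\<bar> \<le> 4 * \<bar>y - x\<bar>"
proof -
  have "tri v - tri w \<le> 4 * \<bar>v - w\<bar>" for v w
  proof -
    obtain k :: int where "tri w = 4 * \<bar>w - of_int k\<bar> - 1" using tri_attained by blast
    then show ?thesis using tri_le[of v k] by (simp add: abs_if split: if_splits)
  qed
  from this[of x y] this[of y x] show ?thesis by (simp add: abs_le_iff abs_minus_commute)
qed

lemma F_diff_bounds:
  assumes "0 \<le> b" "b \<le> 1" "x \<le> y"
  shows "(2 - 2 * b) * (y - x) \<le> F a b y - F a b x"
    and "F a b y - F a b x \<le> (2 + 2 * b) * (y - x)"
proof -
  define s where "s = b / 2 * (tri y - tri x)"
  have "\<bar>s\<bar> \<le> b / 2 * (4 * \<bar>y - x\<bar>)"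
    using assms tri_lipschitz[of y x] unfolding s_def abs_mult by (intro mult_mono) auto
  then have "\<bar>s\<bar> \<le> 2 * b * (y - x)" using assms(3) by (simp add: algebra_simps)
  moreover have "F a b y - F a b x = 2 * (y - x) + s"
    by (simp add: F_def s_def field_simps)
  ultimately show "(2 - 2 * b) * (y - x) \<le> F a b y - F a b x"
    and "F a b y - F a b x \<le> (2 + 2 * b) * (y - x)"
    by (auto simp: left_diff_distrib distrib_right abs_le_iff)
qed

lemma F_mono:
  assumes "0 \<le> b" "b \<le> 1" "x \<le> y"
  shows "F a b x \<le> F a b y"
proof -
  have "0 \<le> (2 - 2 * b) * (y - x)" using assms by simp
  then show ?thesis using F_diff_bounds(1)[OF assms, of a] by linarith
qed

lemma funpow_F_mono:
  assumes "0 \<le> b" "b \<le> 1" "x \<le> y"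
  shows "(F a b ^^ n) x \<le> (F a b ^^ n) y"
  using assms by (induction n) (auto intro: F_mono)

lemma funpow_F_lipschitz:
  assumes "0 \<le> b" "b \<le> 1" "x \<le> y"
  shows "(F a b ^^ n) y - (F a b ^^ n) x \<le> (2 + 2 * b) ^ n * (y - x)"
proof (induction n)
  case (Suc n)
  have "(F a b ^^ Suc n) y - (F a b ^^ Suc n) x \<le> (2 + 2 * b) * ((F a b ^^ n) y - (F a b ^^ n) x)"
    using F_diff_bounds(2)[OF assms(1,2) funpow_F_mono[OF assms]] by simp
  also have "\<dots> \<le> (2 + 2 * b) * ((2 + 2 * b) ^ n * (y - x))"
    using Suc assms by (intro mult_left_mono) auto
  finally show ?case by (simp add: mult.assoc)
qed simp

lemma F_Minus_diff:
  assumes "1/2 \<le> x" "x \<le> 1" "1/2 \<le> y" "y \<le> 1"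
  shows "F a b y - F a b x = (2 - 2 * b) * (y - x)"
proof -
  have "tri x = 3 - 4 * x" "tri y = 3 - 4 * y"
    using assms tri_Minus[of 0 x] tri_Minus[of 0 y] by auto
  then show ?thesis by (simp only: F_def) (simp add: field_simps)
qed

definition multiplier :: "nat \<Rightarrow> real \<Rightarrow> real" where
  "multiplier p b = (2 - 2 * b) * (2 + 2 * b) ^ (p - 1)"

text \<open>The first step is on the branch of small slope \<open>2 - 2 * b\<close>; all later steps have slope at most
  \<open>2 + 2 * b\<close>. So the multiplier of a cycle with itinerary \<open>-+...+\<close> is a Lipschitz
  constant on all of \<open>[1/2, 1]\<close>, including points whose orbits have another itinerary.\<close>

lemma funpow_F_Minus_lipschitz:
  assumes "0 \<le> b" "b \<le> 1" "1/2 \<le> x" "x \<le> y" "y \<le> 1" "0 < p"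
  shows "(F a b ^^ p) y - (F a b ^^ p) x \<le> multiplier p b * (y - x)"
proof -
  obtain n where p: "p = Suc n" using assms gr0_implies_Suc by blast
  have "(F a b ^^ p) y - (F a b ^^ p) x \<le> (2 + 2 * b) ^ n * (F a b y - F a b x)"
    unfolding p funpow_Suc_right o_def
    by (intro funpow_F_lipschitz assms F_mono)
  then show ?thesis using assms by (simp add: F_Minus_diff multiplier_def p mult_ac)
qed

lemma funpow_F_add_int:
  "(F a b ^^ n) (x + of_int k) = (F a b ^^ n) x + of_int (2 ^ n * k)"
proof (induction n)
  case (Suc n)
  then show ?case using tri_add_Ints[of "of_int (2 ^ n * k)" "(F a b ^^ n) x"]
    by (simp add: funpow_F_Suc del: funpow.simps)
qed simp

lemma funpow_F_param_add_int:
  "(F (a + of_int k) b ^^ n) x = (F a b ^^ n) x + of_int ((2 ^ n - 1) * k)"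
proof (induction n)
  case (Suc n)
  then show ?case using tri_add_Ints[of "of_int ((2 ^ n - 1) * k)" "(F a b ^^ n) x"]
    by (simp add: funpow_F_Suc left_diff_distrib del: funpow.simps)
qed simp

lemma funpow_F_param_diff:
  assumes "0 \<le> b" "b \<le> 1" "a \<le> a'" "0 < n"
  shows "a' - a \<le> (F a' b ^^ n) x - (F a b ^^ n) x"
  using \<open>0 < n\<close>
proof (induction n rule: nat_induct_non_zero)
  case 1
  show ?case by (simp add: F_def)
next
  case (Suc n)
  then have "F a' b ((F a b ^^ n) x) \<le> F a' b ((F a' b ^^ n) x)"
    using assms by (intro F_mono) auto
  then show ?case unfolding funpow_F_Suc by (simp add: F_def)
qed

lemma continuous_on_funpow_F:
  "continuous_on UNIV (\<lambda>(a, b). (F a b ^^ n) x)"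
proof (induction n)
  case (Suc n)
  have "continuous_on UNIV (\<lambda>z. 2 * (F (fst z) (snd z) ^^ n) x + fst z
      + snd z / 2 * tri ((F (fst z) (snd z) ^^ n) x))"
    using Suc unfolding case_prod_unfold
    by (intro continuous_intros continuous_on_compose2[OF continuous_on_tri]) auto
  then show ?case by (simp add: funpow_F_Suc case_prod_unfold del: funpow.simps)
qed (simp add: case_prod_unfold)

lemma continuous_funpow_F_point: "continuous_on UNIV (F a b ^^ n)"
proof (induction n)
  case (Suc n)
  show ?case
    unfolding funpow.simps o_def F_def[of a b "(F a b ^^ n) _", abs_def]
    by (intro continuous_intros continuous_on_compose2[OF continuous_on_tri] Suc) auto
qed simp

section \<open>The topology of the circle and of the parameter cylinder\<close>

lemma open_to_circle_image:
  assumes "open V"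
  shows "open (to_circle ` V)"
proof -
  have "to_circle -` to_circle ` V = (\<Union>k. (\<lambda>x. of_int k + x) ` V)"
  proof (intro equalityI subsetI)
    fix x assume "x \<in> to_circle -` to_circle ` V"
    then obtain v where v: "v \<in> V" "x - v \<in> \<int>" by (auto simp: to_circle_eq_iff)
    then obtain k where "x = of_int k + v" by (metis Ints_cases diff_add_cancel)
    with v show "x \<in> (\<Union>k. (\<lambda>x. of_int k + x) ` V)" by blast
  next
    fix x assume "x \<in> (\<Union>k. (\<lambda>x. of_int k + x) ` V)"
    then obtain v k where "v \<in> V" "x = of_int k + v" by blast
    then have "v \<in> V" "to_circle x = to_circle v" by (simp_all add: to_circle_eq_iff)
    then show "x \<in> to_circle -` to_circle ` V" by blast
  qed
  moreover have "open \<dots>" using assms by (intro open_UN ballI open_translation)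
  ultimately show ?thesis by (simp add: open_circle_def)
qed

lemma continuous_on_to_circle: "continuous_on UNIV to_circle"
  by (simp add: continuous_on_open_vimage open_circle_def)

lemma circle_cases: obtains x where "\<alpha> = to_circle x"
  using circle.abs_induct[of "\<lambda>\<alpha>. \<exists>x. \<alpha> = to_circle x"] by blast

lemma to_circle_add_int: "to_circle (x + of_int k) = to_circle x"
  by (simp add: to_circle_eq_iff)

text \<open>The projection of the plane onto the cylinder is open, hence a quotient map.\<close>

lemma open_cylinderI:
  fixes U :: "(circle \<times> 'b::topological_space) set"
  assumes "open {(a, b). (to_circle a, b) \<in> U}"
  shows "open U"
proof (rule open_prod_intro)
  fix z assume "z \<in> U"
  obtain \<alpha> b where z: "z = (\<alpha>, b)" by force
  obtain a where a: "\<alpha> = to_circle a" by (rule circle_cases)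
  have "(a, b) \<in> {(a, b). (to_circle a, b) \<in> U}" using \<open>z \<in> U\<close> z a by simp
  then obtain A B where AB: "open A" "open B" "(a, b) \<in> A \<times> B"
      "A \<times> B \<subseteq> {(a, b). (to_circle a, b) \<in> U}"
    using open_prod_elim[OF assms] by metis
  show "\<exists>A B. open A \<and> open B \<and> z \<in> A \<times> B \<and> A \<times> B \<subseteq> U"
    using AB z a open_to_circle_image by (intro exI[of _ "to_circle ` A"] exI[of _ B]) auto
qed

lemma closed_cylinderI:
  fixes K :: "(circle \<times> 'b::topological_space) set"
  assumes "closed {(a, b). (to_circle a, b) \<in> K}"
  shows "closed K"
proof -
  have "{(a, b). (to_circle a, b) \<in> - K} = - {(a, b). (to_circle a, b) \<in> K}" by auto
  then show ?thesis using assms open_cylinderI[of "- K"] by (simp add: closed_def)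
qed

text \<open>Composing with \<open>tri\<close> turns convergence in the quotient topology into convergence to zero of the
  distance to the lifts \<open>x + k\<close> of the limit.\<close>

lemma tri_tendsto_of_circle_tendsto:
  assumes "(\<lambda>n. to_circle (r n)) \<longlonglongrightarrow> to_circle x"
  shows "(\<lambda>n. tri (r n - x)) \<longlonglongrightarrow> -1"
proof (rule topological_tendstoI)
  fix T :: "real set" assume T: "open T" "-1 \<in> T"
  have "continuous_on UNIV (\<lambda>z. tri (z - x))"
    by (intro continuous_on_compose2[OF continuous_on_tri] continuous_intros) auto
  then have "open ((\<lambda>z. tri (z - x)) -` T)"
    using T by (simp add: continuous_on_open_vimage)
  moreover have "tri 0 = -1" by (simp add: tri_def)
  ultimately have "\<forall>\<^sub>F n in sequentially. to_circle (r n) \<in> to_circle ` ((\<lambda>z. tri (z - x)) -` T)"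
    using T by (intro topological_tendstoD[OF assms] open_to_circle_image) auto
  then show "\<forall>\<^sub>F n in sequentially. tri (r n - x) \<in> T"
  proof eventually_elim
    case (elim n)
    then obtain z where z: "tri (z - x) \<in> T" "r n - z \<in> \<int>" by (auto simp: to_circle_eq_iff)
    have "tri (z - x + (r n - z)) = tri (z - x)" by (rule tri_add_Ints[OF z(2)])
    with z show ?case by simp
  qed
qed

lemma fmap_to_circle: "fmap (to_circle a) b (to_circle x) = to_circle (F a b x)"
  by (simp add: fmap.abs_eq F_def)

lemma funpow_fmap_to_circle:
  "(fmap (to_circle a) b ^^ n) (to_circle x) = to_circle ((F a b ^^ n) x)"
  by (induction n) (simp_all add: fmap_to_circle)

lemma open_vimage_funpow_fmap:
  assumes "open U"
  shows "open ((fmap \<alpha> b ^^ n) -` U)"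
proof -
  obtain a where a: "\<alpha> = to_circle a" by (rule circle_cases)
  have "to_circle -` ((fmap \<alpha> b ^^ n) -` U) = (F a b ^^ n) -` (to_circle -` U)"
    by (auto simp: a funpow_fmap_to_circle)
  moreover have "open \<dots>"
    using assms continuous_funpow_F_point[of n a b]
    by (simp add: continuous_on_open_vimage open_circle_def)
  ultimately show ?thesis by (simp add: open_circle_def)
qed

lemma slope_interval_PlusD:
  assumes "to_circle y \<in> slope_interval Plus" "to_circle y \<notin> {to_circle 0, to_circle (1/2)}"
  obtains k :: int where "of_int k < y" "y < of_int k + 1/2"
proof -
  obtain z where z: "0 \<le> z" "z \<le> 1/2" "to_circle y = to_circle z" using assms by auto
  then obtain k where "y = z + of_int k" by (metis Ints_cases add.commute diff_add_cancel to_circle_eq_iff)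
  moreover have "z \<noteq> 0" "z \<noteq> 1/2" using z(3) assms(2) by blast+
  ultimately show ?thesis using that[of k] z by auto
qed

lemma slope_interval_MinusD:
  assumes "\<alpha> \<in> slope_interval Minus" "\<alpha> \<notin> {to_circle 0, to_circle (1/2)}"
  obtains x where "\<alpha> = to_circle x" "1/2 < x" "x < 1"
proof -
  obtain z where z: "1/2 \<le> z" "z \<le> 1" "\<alpha> = to_circle z" using assms by auto
  moreover have "to_circle 1 = to_circle 0" by (simp add: to_circle_eq_iff)
  then have "z \<noteq> 1" "z \<noteq> 1/2" using z(3) assms(2) by blast+
  ultimately show ?thesis using that[of z] by auto
qed

section \<open>Attraction forces the multiplier below one\<close>

lemma funpow_F_locally_affine:
  assumes x: "1/2 < x" "x < 1"
    and orbit: "\<And>j. 0 < j \<Longrightarrow> j < p \<Longrightarrow> \<exists>k::int. of_int k < (F a b ^^ j) x \<and> (F a b ^^ j) x < of_int k + 1/2"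
    and n: "0 < n" "n \<le> p"
  shows "\<forall>\<^sub>F z in nhds x. (F a b ^^ n) z = (F a b ^^ n) x + multiplier n b * (z - x)"
  using n
proof (induction n rule: nat_induct_non_zero)
  case 1
  have "\<forall>\<^sub>F z in nhds x. z \<in> {1/2<..<1}" using x by (intro eventually_nhds_in_open) auto
  then show ?case
  proof eventually_elim
    case (elim z)
    then show ?case using F_Minus_diff[of x z a b] x by (simp add: multiplier_def)
  qed
next
  case (Suc n)
  then obtain k :: int where k: "of_int k < (F a b ^^ n) x" "(F a b ^^ n) x < of_int k + 1/2"
    using orbit[of n] by auto
  have "isCont (F a b ^^ n) x"
    using continuous_funpow_F_point by (simp add: continuous_on_eq_continuous_at)
  then have "\<forall>\<^sub>F z in nhds x. (F a b ^^ n) z \<in> {of_int k<..<of_int k + 1/2}"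
    using k by (intro topological_tendstoD[OF isContD[unfolded tendsto_at_iff_tendsto_nhds]]) auto
  moreover have "\<forall>\<^sub>F z in nhds x. (F a b ^^ n) z = (F a b ^^ n) x + multiplier n b * (z - x)"
    using Suc by simp
  ultimately show ?case
  proof eventually_elim
    case (elim z)
    have "tri ((F a b ^^ n) z) - tri ((F a b ^^ n) x) = 4 * (multiplier n b * (z - x))"
      using k elim tri_Plus[of k "(F a b ^^ n) z"] tri_Plus[of k "(F a b ^^ n) x"] by simp
    then have "tri ((F a b ^^ n) z) = tri ((F a b ^^ n) x) + 4 * (multiplier n b * (z - x))"
      by linarith
    then have "(F a b ^^ Suc n) z = (F a b ^^ Suc n) x + (2 + 2 * b) * (multiplier n b * (z - x))"
      unfolding funpow_F_Suc elim(2) by (simp only: distrib_left distrib_right)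
    moreover have "multiplier (Suc n) b = (2 + 2 * b) * multiplier n b"
      using Suc.hyps by (cases n) (simp_all add: multiplier_def)
    ultimately show ?case by (simp add: mult.assoc)
  qed
qed

lemma funpow_F_inj:
  assumes "0 \<le> b" "b < 1"
  shows "inj (F a b ^^ n)"
proof (rule inj_fn, rule linorder_injI)
  fix x y :: real assume "x < y"
  then have "0 < (2 - 2 * b) * (y - x)" using assms by simp
  then show "F a b x \<noteq> F a b y" using F_diff_bounds(1)[of b x y a] assms \<open>x < y\<close> by linarith
qed

text \<open>If the multiplier \<open>q\<close> is at least one, then \<open>F ^ p\<close>, affine of slope \<open>q\<close> near the cycle, does not
  decrease small distances to the orbit, so a point can converge to the cycle only by landing on it exactly.
  As \<open>F\<close> is injective for \<open>b < 1\<close>, only countably many points do so, and they cannot fill a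
  neighbourhood. This argument covers the neutral case \<open>q = 1\<close>, where the derivative alone does not
  decide.\<close>

lemma multiplier_less_1:
  assumes b: "0 \<le> b" "b \<le> 1" and p: "0 < p"
    and x: "1/2 < x" "x < 1"
    and orbit: "\<And>j. 0 < j \<Longrightarrow> j < p \<Longrightarrow> \<exists>k::int. of_int k < (F a b ^^ j) x \<and> (F a b ^^ j) x < of_int k + 1/2"
    and fixed: "(F a b ^^ p) x = x + of_int m"
    and attr: "attracting_cycle (fmap (to_circle a) b) p (to_circle x)"
  shows "multiplier p b < 1"
proof (rule ccontr)
  define q where "q = multiplier p b"
  define G where "G = F a b ^^ p"
  assume "\<not> multiplier p b < 1"
  then have q: "q \<ge> 1" by (simp add: q_def)
  then have "b < 1" using b by (cases "b = 1") (auto simp: q_def multiplier_def)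
  have Gn: "G ^^ n = F a b ^^ (p * n)" for n by (simp add: G_def funpow_mult mult.commute)
  obtain U where U: "open U" "to_circle x \<in> U"
    and lim: "\<And>y. y \<in> U \<Longrightarrow> (\<lambda>n. ((fmap (to_circle a) b ^^ p) ^^ n) y) \<longlonglongrightarrow> to_circle x"
    using attr p unfolding attracting_cycle_def by (metis funpow_0)
  have "\<forall>\<^sub>F z in nhds x. G z = x + of_int m + q * (z - x)"
    using funpow_F_locally_affine[OF x orbit p order_refl] by (simp add: G_def q_def fixed)
  then obtain d where d: "d > 0" and affine: "\<And>z. \<bar>z - x\<bar> < d \<Longrightarrow> G z = x + of_int m + q * (z - x)"
    by (auto simp: eventually_nhds_metric dist_real_def)
  define e where "e = min d (1 / (2 * q))"
  have e: "e > 0" using d q by (simp add: e_def)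
  \<comment> \<open>Within distance \<open>e\<close> of a lift of the fixed point \<open>G\<close> is affine, and the stretched distance is
    at most \<open>1/2\<close>, so it is still the distance to the nearest lift.\<close>
  have grow: "tri (G z - x) \<ge> tri (z - x)" if "(tri (z - x) + 1) / 4 < e" for z
  proof -
    obtain k :: int where k: "tri (z - x) = 4 * \<bar>z - x - of_int k\<bar> - 1"
      using tri_attained by blast
    define w where "w = z - of_int k"
    have w: "\<bar>w - x\<bar> < e" using that k by (simp add: w_def algebra_simps)
    then have "G w = x + of_int m + q * (w - x)" by (intro affine) (simp add: e_def)
    moreover have "G z = G w + of_int (2 ^ p * k)"
      using funpow_F_add_int[where n = p and x = w and k = k and a = a and b = b]
      by (simp add: G_def w_def)
    ultimately have "G z - x = q * (w - x) + of_int (m + 2 ^ p * k)" by simp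
    then have "tri (G z - x) = tri (q * (w - x))" using tri_add_Ints by simp
    also have "\<dots> = 4 * \<bar>q * (w - x)\<bar> - 1"
    proof -
      have "q * \<bar>w - x\<bar> \<le> q * (1 / (2 * q))" using w q by (intro mult_left_mono) (auto simp: e_def)
      then have "\<bar>q * (w - x)\<bar> \<le> 1/2" using q by (simp add: abs_mult)
      then show ?thesis
        using tri_Plus[of 0 "q * (w - x)"] tri_Minus[of "-1" "q * (w - x)"] by (auto simp: abs_if)
    qed
    also have "\<dots> \<ge> 4 * \<bar>w - x\<bar> - 1" using q by (simp add: abs_mult mult_le_cancel_right1)
    finally show ?thesis using k by (simp add: w_def algebra_simps)
  qed
  have lands: "\<exists>n. (G ^^ n) y - x \<in> \<int>" if "to_circle y \<in> U" for y
  proof -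
    define r where "r = (\<lambda>n. (G ^^ n) y)"
    have "((fmap (to_circle a) b ^^ p) ^^ n) (to_circle y) = to_circle (r n)" for n
      by (simp add: r_def Gn funpow_mult funpow_fmap_to_circle mult.commute)
    then have lim0: "(\<lambda>n. tri (r n - x)) \<longlonglongrightarrow> -1"
      using lim[OF that] tri_tendsto_of_circle_tendsto by simp
    then have "\<forall>\<^sub>F n in sequentially. tri (r n - x) < 4 * e - 1"
      by (rule order_tendstoD) (use e in simp)
    then obtain n0 where n0: "\<And>n. n \<ge> n0 \<Longrightarrow> tri (r n - x) < 4 * e - 1"
      by (auto simp: eventually_sequentially)
    have "tri (r (n0 + i) - x) \<ge> tri (r n0 - x)" for i
    proof (induction i)
      case (Suc i)
      have "tri (r (Suc (n0 + i)) - x) \<ge> tri (r (n0 + i) - x)"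
        using grow[of "r (n0 + i)"] n0[of "n0 + i"] by (simp add: r_def)
      with Suc show ?case by simp
    qed simp
    then have "-1 \<ge> tri (r n0 - x)"
      by (intro LIMSEQ_le_const[OF LIMSEQ_ignore_initial_segment[OF lim0, of n0]])
        (auto simp: add.commute)
    moreover obtain k :: int where "tri (r n0 - x) = 4 * \<bar>r n0 - x - of_int k\<bar> - 1"
      using tri_attained by blast
    ultimately have "r n0 - x = of_int k" by simp
    then show ?thesis unfolding r_def by (intro exI[of _ n0]) simp
  qed
  have "countable {y. (G ^^ n) y - x \<in> \<int>}" for n
  proof (rule countable_image_inj_on)
    have "(G ^^ n) ` {y. (G ^^ n) y - x \<in> \<int>} \<subseteq> range (\<lambda>k::int. x + of_int k)"
      by (auto elim!: Ints_cases simp: algebra_simps intro!: image_eqI)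
    then show "countable ((G ^^ n) ` {y. (G ^^ n) y - x \<in> \<int>})"
      by (rule countable_subset) simp
    show "inj_on (G ^^ n) {y. (G ^^ n) y - x \<in> \<int>}"
      using funpow_F_inj[OF b(1) \<open>b < 1\<close>] by (auto simp: Gn intro: inj_on_subset)
  qed
  then have "countable (\<Union>n. {y. (G ^^ n) y - x \<in> \<int>})" by blast
  moreover have "to_circle -` U \<subseteq> (\<Union>n. {y. (G ^^ n) y - x \<in> \<int>})" using lands by auto
  ultimately have "countable (to_circle -` U)" using countable_subset by blast
  moreover have "open (to_circle -` U)" "x \<in> to_circle -` U" using U by (auto simp: open_circle_def)
  then obtain r where "r > 0" "ball x r \<subseteq> to_circle -` U" by (meson open_contains_ball)
  ultimately show False using uncountable_ball countable_subset by blast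
qed


section \<open>The class of a parameter\<close>

text \<open>If \<open>F a b ^^ p\<close> maps some \<open>x\<close> in \<open>[1/2, 1]\<close> to \<open>x + of_int k\<close> with multiplier at most one,
  then the level lies in \<open>[k, k + 1/2]\<close>. It serves as a continuous function of the
  parameters from which \<open>k\<close> can be read off.\<close>

definition level :: "nat \<Rightarrow> real \<Rightarrow> real \<Rightarrow> real" where
  "level p a b = (F a b ^^ p) (1/2) - 1/2"

lemma continuous_on_level: "continuous_on UNIV (\<lambda>(a, b). level p a b)"
  using continuous_on_diff[OF continuous_on_funpow_F[of p "1/2"] continuous_on_const[of UNIV "1/2"]]
  by (simp add: level_def case_prod_unfold)

lemma level_add_int: "level p (a + of_int j) b = level p a b + of_int ((2 ^ p - 1) * j)"
  unfolding level_def funpow_F_param_add_int by simp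

text \<open>A point of the circle determines its lift \<open>a\<close> only up to an integer, and the level only up to a
  multiple of \<open>2 ^ p - 1\<close>. The condition below is independent of the lift when \<open>A\<close> is a union
  of residue classes modulo \<open>2 ^ p - 1\<close>.\<close>

definition band :: "nat \<Rightarrow> int set \<Rightarrow> (circle \<times> real) set" where
  "band p A = {(to_circle a, b) | a b. \<exists>k\<in>A. level p a b \<in> {of_int k..of_int k + 1/2}}"

definition residue_class :: "nat \<Rightarrow> int \<Rightarrow> int set" where
  "residue_class p m = {k. (2 ^ p - 1) dvd (k - m)}"

lemma residue_class_add: "k + (2 ^ p - 1) * j \<in> residue_class p m \<longleftrightarrow> k \<in> residue_class p m"
proof -
  have "k + (2 ^ p - 1) * j - m = (k - m) + (2 ^ p - 1) * j" by simp
  then show ?thesis unfolding residue_class_def mem_Collect_eq by (metis dvd_add_times_triv_right_iff mult.commute)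
qed

lemma band_iff:
  assumes A: "\<And>k j. k + (2 ^ p - 1) * j \<in> A \<longleftrightarrow> k \<in> A"
  shows "(to_circle a, b) \<in> band p A \<longleftrightarrow> (\<exists>k\<in>A. level p a b \<in> {of_int k..of_int k + 1/2})"
proof
  assume "(to_circle a, b) \<in> band p A"
  then obtain a' k where k: "to_circle a = to_circle a'" "k \<in> A"
      "level p a' b \<in> {of_int k..of_int k + 1/2}"
    by (auto simp: band_def)
  then obtain j where "a = a' + of_int j"
    by (metis Ints_cases add.commute diff_add_cancel to_circle_eq_iff)
  then have "level p a b \<in> {of_int (k + (2 ^ p - 1) * j)..of_int (k + (2 ^ p - 1) * j) + 1/2}"
    using k(3) by (simp only: level_add_int) simp
  then show "\<exists>k\<in>A. level p a b \<in> {of_int k..of_int k + 1/2}" using A k(2) by blast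
qed (auto simp: band_def)

lemma band_index_unique:
  fixes k l :: int and t :: real
  assumes "t \<in> {of_int k..of_int k + 1/2}" "t \<in> {of_int l..of_int l + 1/2}"
  shows "k = l"
proof -
  have "\<lfloor>t\<rfloor> = k" "\<lfloor>t\<rfloor> = l" using assms by (simp_all add: floor_unique)
  then show ?thesis by simp
qed

lemma closed_band:
  assumes A: "\<And>k j. k + (2 ^ p - 1) * j \<in> A \<longleftrightarrow> k \<in> A"
  shows "closed (band p A)"
proof (rule closed_cylinderI)
  define C where "C = (\<Union>x\<in>of_int ` A. \<Union>y\<in>{0..1/2::real}. {x + y})"
  have "closed C"
    unfolding C_def by (intro closed_compact_sums closed_subset_Ints compact_Icc) auto
  moreover have "{(a, b). (to_circle a, b) \<in> band p A} = (\<lambda>(a, b). level p a b) -` C"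
  proof -
    have "(\<exists>k\<in>A. t \<in> {of_int k..of_int k + 1/2}) \<longleftrightarrow> t \<in> C" for t :: real
    proof
      assume "\<exists>k\<in>A. t \<in> {of_int k..of_int k + 1/2}"
      then obtain k where "k \<in> A" "t - of_int k \<in> {0..1/2}" "t = of_int k + (t - of_int k)" by auto
      then show "t \<in> C" unfolding C_def by blast
    next
      assume "t \<in> C"
      then obtain k y where "k \<in> A" "0 \<le> y" "y \<le> 1/2" "t = of_int k + y" by (auto simp: C_def)
      then show "\<exists>k\<in>A. t \<in> {of_int k..of_int k + 1/2}" by (intro bexI[of _ k]) auto
    qed
    then show ?thesis by (auto simp: band_iff[OF A])
  qed
  ultimately show "closed {(a, b). (to_circle a, b) \<in> band p A}"
    using continuous_on_level[of p] by (simp add: continuous_on_closed_vimage)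
qed

lemma band_disjoint:
  assumes A: "\<And>k j. k + (2 ^ p - 1) * j \<in> A \<longleftrightarrow> k \<in> A"
  shows "band p A \<inter> band p (- A) = {}"
proof -
  have "(to_circle a, b) \<notin> band p A \<inter> band p (- A)" for a b
  proof
    assume "(to_circle a, b) \<in> band p A \<inter> band p (- A)"
    then obtain k l where "k \<in> A" "l \<notin> A" "level p a b \<in> {of_int k..of_int k + 1/2}"
        "level p a b \<in> {of_int l..of_int l + 1/2}"
      using A by (auto simp: band_iff)
    moreover from this have "k = l" by (metis band_index_unique)
    ultimately show False by simp
  qed
  then show ?thesis by (metis all_not_in_conv circle_cases prod.exhaust)
qed

definition itinerary :: "nat \<Rightarrow> slope list" where
  "itinerary p = Minus # replicate (p - 1) Plus"

lemma length_itinerary: "0 < p \<Longrightarrow> length (itinerary p) = p"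
  by (simp add: itinerary_def)

lemma itinerary_nth: "j < p \<Longrightarrow> itinerary p ! j = (if j = 0 then Minus else Plus)"
  by (simp add: itinerary_def nth_Cons')

text \<open>With \<open>x\<close> the lift of the point of sign \<open>-\<close>, the Lipschitz bound with constant less than one gives
  \<open>F a b ^^ p\<close> a drop of at most \<open>x - 1/2\<close> from \<open>x\<close> to \<open>1/2\<close>, hence a level of at least \<open>m\<close>;
  monotonicity gives a level of at most \<open>m + x - 1/2\<close>.\<close>

lemma itinerary_level:
  assumes p: "0 < p" and b: "0 \<le> b" "b \<le> 1"
    and attr: "attracting_cycle (fmap (to_circle a) b) p \<xi>"
    and itin: "has_itinerary (fmap (to_circle a) b) \<xi> (itinerary p)"
  obtains x m where "\<xi> = to_circle x" "1/2 < x" "x < 1" "(F a b ^^ p) x = x + of_int m"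
    "level p a b \<in> {of_int m..of_int m + 1/2}"
proof -
  have orb: "(fmap (to_circle a) b ^^ j) \<xi> \<notin> {to_circle 0, to_circle (1/2)}"
      "(fmap (to_circle a) b ^^ j) \<xi> \<in> slope_interval (if j = 0 then Minus else Plus)" if "j < p" for j
    using itin that p unfolding has_itinerary_def by (simp_all add: length_itinerary itinerary_nth)
  obtain x where x: "\<xi> = to_circle x" "1/2 < x" "x < 1"
    using orb[of 0] p slope_interval_MinusD[of \<xi>] by auto
  have orbit: "\<exists>k::int. of_int k < (F a b ^^ j) x \<and> (F a b ^^ j) x < of_int k + 1/2" if "0 < j" "j < p" for j
  proof -
    have "to_circle ((F a b ^^ j) x) \<in> slope_interval Plus"
        "to_circle ((F a b ^^ j) x) \<notin> {to_circle 0, to_circle (1/2)}"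
      using orb[OF that(2)] that(1) by (simp_all add: x(1) funpow_fmap_to_circle del: slope_interval.simps)
    then show ?thesis by (rule slope_interval_PlusD) blast
  qed
  have "to_circle ((F a b ^^ p) x) = to_circle x"
    using attr by (simp add: attracting_cycle_def exact_period_def x(1) funpow_fmap_to_circle)
  then obtain m where m: "(F a b ^^ p) x = x + of_int m"
    by (metis Ints_cases add.commute diff_add_cancel to_circle_eq_iff)
  have "multiplier p b < 1"
    using multiplier_less_1[OF b p x(2,3) orbit m] attr x(1) by simp
  then have "multiplier p b * (x - 1/2) \<le> x - 1/2"
    using x by (simp add: mult_le_cancel_right1)
  moreover have "(F a b ^^ p) x - (F a b ^^ p) (1/2) \<le> multiplier p b * (x - 1/2)"
    using x p b by (intro funpow_F_Minus_lipschitz) auto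
  moreover have "(F a b ^^ p) (1/2) \<le> (F a b ^^ p) x"
    using x b by (intro funpow_F_mono) auto
  ultimately have "level p a b \<in> {of_int m..of_int m + 1/2}"
    using m x by (simp add: level_def, linarith)
  with x m show ?thesis using that by blast
qed

text \<open>Iterating the functional equation of \<open>Phi\<close> along the cycle gives \<open>2 ^ p * T = T + m\<close> for
  \<open>T = Phi \<alpha> b x\<close>.\<close>

lemma Phi_fixed:
  assumes a: "Flift \<alpha> b = F a b" and x: "(F a b ^^ p) x = x + of_int m" and p: "0 < p"
  shows "Phi \<alpha> b x = of_int m / (2 ^ p - 1)"
proof -
  have Phi_F: "Phi \<alpha> b ((F a b ^^ n) y) = 2 ^ n * Phi \<alpha> b y" for n y
  proof -
    have "(\<lambda>k. 2 ^ n * ((Flift \<alpha> b ^^ (k + n)) y / 2 ^ (k + n))) \<longlonglongrightarrow> 2 ^ n * Phi \<alpha> b y"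
      by (intro tendsto_intros LIMSEQ_ignore_initial_segment Phi_LIMSEQ)
    then have "(\<lambda>k. (Flift \<alpha> b ^^ k) ((F a b ^^ n) y) / 2 ^ k) \<longlonglongrightarrow> 2 ^ n * Phi \<alpha> b y"
      by (simp add: a funpow_add power_add)
    then show ?thesis using Phi_LIMSEQ LIMSEQ_unique by blast
  qed
  have "2 ^ p * Phi \<alpha> b x = Phi \<alpha> b x + of_int m"
    using Phi_F[of p x] Phi_add_Ints[of "of_int m" \<alpha> b x] by (simp add: x)
  moreover have "(2::real) ^ p > 1" using p by simp
  ultimately show ?thesis by (simp add: field_simps)
qed

text \<open>The parameter \<open>\<alpha>\<close> has a lift \<open>a\<close> for which \<open>F a b 0 = a - b / 2\<close> lies in \<open>[0, 1)\<close>, which is the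
  normalization of \<open>Flift\<close>.\<close>

lemma Flift_eq_F: obtains a where "\<alpha> = to_circle a" "Flift \<alpha> b = F a b"
proof -
  obtain a0 where a0: "\<alpha> = to_circle a0" by (rule circle_cases)
  define a where "a = a0 - of_int \<lfloor>a0 - b / 2\<rfloor>"
  have "\<alpha> = to_circle a" by (simp add: a0 a_def to_circle_eq_iff)
  moreover have "a - b / 2 = frac (a0 - b / 2)" by (simp add: a_def frac_def)
  then have "frac (a - b / 2) = a - b / 2" using frac_frac[of "a0 - b / 2"] by simp
  then have "Flift (to_circle a) b = F a b"
    unfolding Flift_explicit by (simp add: fun_eq_iff F_def field_simps)
  ultimately show ?thesis using that[of a] by simp
qed

lemma itinerary_params_subset_bands:
  assumes "0 < p"
  shows "itinerary_params (itinerary p) \<subseteq> band p (residue_class p m) \<union> band p (- residue_class p m)"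
proof
  fix z assume z: "z \<in> itinerary_params (itinerary p)"
  obtain a b where ab: "z = (to_circle a, b)" by (metis circle_cases prod.exhaust)
  obtain \<xi> where "0 \<le> b" "b \<le> 1" "attracting_cycle (fmap (to_circle a) b) p \<xi>"
      "has_itinerary (fmap (to_circle a) b) \<xi> (itinerary p)"
    using z assms by (auto simp: ab itinerary_params_def length_itinerary)
  then obtain k where "level p a b \<in> {of_int k..of_int k + 1/2}"
    using itinerary_level[OF assms] by metis
  then show "z \<in> band p (residue_class p m) \<union> band p (- residue_class p m)"
    unfolding band_def ab by blast
qed

lemma has_type_band:
  assumes p: "0 < p" and z: "(\<alpha>, b) \<in> itinerary_params (itinerary p)"
    and band: "(\<alpha>, b) \<in> band p (residue_class p m)"
  shows "has_type \<alpha> b (to_circle (of_int m / (2 ^ p - 1)))"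
proof -
  obtain a where a: "\<alpha> = to_circle a" "Flift \<alpha> b = F a b" by (rule Flift_eq_F)
  obtain \<xi> where \<xi>: "0 \<le> b" "b \<le> 1" "attracting_cycle (fmap \<alpha> b) p \<xi>"
      "has_itinerary (fmap \<alpha> b) \<xi> (itinerary p)"
    using z p by (auto simp: itinerary_params_def length_itinerary)
  obtain x k where x: "\<xi> = to_circle x" "1/2 < x" "x < 1" "(F a b ^^ p) x = x + of_int k"
      and k: "level p a b \<in> {of_int k..of_int k + 1/2}"
    using itinerary_level[OF p \<xi>(1,2)] \<xi>(3,4) unfolding a(1) by metis
  obtain l where l: "l \<in> residue_class p m" "level p a b \<in> {of_int l..of_int l + 1/2}"
    using band residue_class_add by (auto simp: a(1) band_iff)
  have "k = l" by (rule band_index_unique[OF k l(2)])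
  then obtain j where "k - m = (2 ^ p - 1) * j" using l(1) by (auto simp: residue_class_def)
  then have "real_of_int k - of_int m = of_int ((2 ^ p - 1) * j)" by (metis of_int_diff)
  moreover have "(2::real) ^ p - 1 \<noteq> 0" using p by (rule two_power_minus_1_nonzero)
  ultimately have "real_of_int k / (2 ^ p - 1) - of_int m / (2 ^ p - 1) = of_int j"
    by (simp flip: diff_divide_distrib)
  then have "phi \<alpha> b \<xi> = to_circle (of_int m / (2 ^ p - 1))"
    using Phi_fixed[OF a(2) x(4) p] by (simp add: x(1) phi.abs_eq to_circle_eq_iff)
  moreover have "\<xi> \<in> slope_interval Minus" using x by auto
  moreover have "single_minus (itinerary p)"
    by (simp add: single_minus_def itinerary_def count_list_0_iff)
  ultimately show ?thesis unfolding has_type_def using \<xi> p by (metis length_itinerary)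
qed


section \<open>The boundary circle of superattracting parameters\<close>

lemma funpow_F_flat:
  assumes "1/2 \<le> x" "x \<le> 1" "1/2 \<le> y" "y \<le> 1" "0 < n"
  shows "(F a 1 ^^ n) x = (F a 1 ^^ n) y"
proof -
  have "F a 1 x = F a 1 y" using F_Minus_diff[OF assms(3,4,1,2), of a 1] by simp
  then show ?thesis using \<open>0 < n\<close> by (cases n) (simp_all add: funpow_Suc_right del: funpow.simps)
qed

text \<open>A neighbourhood of \<open>\<xi>\<close> that \<open>f ^^ p\<close> collapses to \<open>\<xi>\<close> can be pulled back by \<open>f ^^ (p - j)\<close> to the other
  points of the cycle. A point in the pull-back reaches \<open>\<xi>\<close> after \<open>2 * p - j\<close> steps, hence
  \<open>f ^^ j\<close> of \<open>\<xi>\<close> after \<open>2 * p\<close> steps, and stays there under \<open>f ^^ p\<close>.\<close>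

lemma attracting_cycle_if_locally_constant:
  assumes per: "exact_period f p \<xi>" and V: "open V" "\<xi> \<in> V" "\<And>y. y \<in> V \<Longrightarrow> (f ^^ p) y = \<xi>"
    and cont: "\<And>n U. open U \<Longrightarrow> open ((f ^^ n) -` U)"
  shows "attracting_cycle f p \<xi>"
  unfolding attracting_cycle_def
proof (intro conjI per allI impI)
  fix j assume j: "j < p"
  have fixed: "((f ^^ p) ^^ n) \<xi> = \<xi>" for n
    using V(2,3) by (induction n) auto
  show "\<exists>U. open U \<and> (f ^^ j) \<xi> \<in> U \<and> (\<forall>y\<in>U. (\<lambda>n. ((f ^^ p) ^^ n) y) \<longlonglongrightarrow> (f ^^ j) \<xi>)"
  proof (intro exI[of _ "(f ^^ (p - j)) -` V"] conjI ballI)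
    show "open ((f ^^ (p - j)) -` V)" by (rule cont[OF V(1)])
    have "(f ^^ (p - j)) ((f ^^ j) \<xi>) = (f ^^ p) \<xi>"
      using j by (simp flip: funpow_add comp_apply[of "f ^^ _" "f ^^ _"])
    then show "(f ^^ j) \<xi> \<in> (f ^^ (p - j)) -` V" using V by simp
    fix y assume y: "y \<in> (f ^^ (p - j)) -` V"
    have "((f ^^ p) ^^ n) y = (f ^^ j) \<xi>" if "n \<ge> 2" for n
    proof -
      obtain i where i: "n = i + 2" using \<open>n \<ge> 2\<close> by (metis add.commute le_Suc_ex)
      have "p * n = j + (p * i + (p + (p - j)))" using j by (simp add: i)
      then have "((f ^^ p) ^^ n) y = (f ^^ j) (((f ^^ p) ^^ i) ((f ^^ p) ((f ^^ (p - j)) y)))"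
        by (simp add: funpow_mult mult.commute[of _ p] funpow_add)
      then show ?thesis using V(3) y fixed by simp
    qed
    then show "(\<lambda>n. ((f ^^ p) ^^ n) y) \<longlonglongrightarrow> (f ^^ j) \<xi>"
      by (intro tendsto_eventually) (auto simp: eventually_sequentially)
  qed
qed

text \<open>Suppose \<open>y + k\<close> with \<open>y\<close> in \<open>[1/2, 1]\<close> is the \<open>j\<close>-th iterate of \<open>x\<close>. Then \<open>y\<close> and \<open>x\<close> have the
  same image under \<open>F a 1 ^^ p\<close>, and comparing the two ways to iterate \<open>j + p\<close> times from \<open>x\<close> shows that
  \<open>y - x\<close> is an integer, hence zero. What remains of the comparison is
  \<open>(2 ^ p - 1) * k = (2 ^ j - 1) * m\<close>: the point \<open>m / (2 ^ p - 1)\<close> would return to itself under \<open>j\<close>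
  doublings modulo one, contrary to the last assumption.\<close>

lemma superattracting_orbit_Plus:
  assumes p: "0 < p" and x: "1/2 < x" "x < 1" "(F a 1 ^^ p) x = x + of_int m"
    and j: "0 < j" "j < p"
    and exact: "(2 ^ j - 1) * (of_int m / (2 ^ p - 1)) \<notin> (\<int> :: real set)"
  shows "\<exists>k::int. of_int k < (F a 1 ^^ j) x \<and> (F a 1 ^^ j) x < of_int k + 1/2"
proof -
  have not_Minus: "\<not> (1/2 \<le> y \<and> y \<le> 1)" if y: "(F a 1 ^^ j) x = y + of_int k" for y k
  proof
    assume "1/2 \<le> y \<and> y \<le> 1"
    then have "(F a 1 ^^ p) y = x + of_int m" using x p funpow_F_flat[of y x p a] by simp
    then have "(F a 1 ^^ p) ((F a 1 ^^ j) x) = x + of_int m + of_int (2 ^ p * k)"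
      by (simp add: y funpow_F_add_int)
    moreover have "(F a 1 ^^ p) ((F a 1 ^^ j) x) = (F a 1 ^^ j) ((F a 1 ^^ p) x)"
      by (metis add.commute comp_apply funpow_add)
    then have "(F a 1 ^^ p) ((F a 1 ^^ j) x) = y + of_int k + of_int (2 ^ j * m)"
      by (simp add: x(3) funpow_F_add_int y)
    ultimately have eq: "y - x = of_int (m + 2 ^ p * k - k - 2 ^ j * m)" by simp
    have "\<bar>y - x\<bar> < 1" using \<open>1/2 \<le> y \<and> y \<le> 1\<close> x by linarith
    then have "m + 2 ^ p * k - k - 2 ^ j * m = 0" unfolding eq by linarith
    then have "(2 ^ p - 1) * k = (2 ^ j - 1) * m" by (simp add: algebra_simps)
    then have "real_of_int ((2 ^ p - 1) * k) = of_int ((2 ^ j - 1) * m)" by simp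
    moreover have "(2::real) ^ p - 1 \<noteq> 0" using p by (rule two_power_minus_1_nonzero)
    ultimately have "(2 ^ j - 1) * (of_int m / (2 ^ p - 1)) = real_of_int k"
      by (simp add: field_simps)
    with exact show False by simp
  qed
  define z where "z = (F a 1 ^^ j) x"
  have "\<not> 1/2 \<le> z - of_int \<lfloor>z\<rfloor>"
    using not_Minus[of "z - of_int \<lfloor>z\<rfloor>" "\<lfloor>z\<rfloor>"] by (auto simp: z_def[symmetric]) linarith
  moreover have "z \<noteq> of_int \<lfloor>z\<rfloor>"
    using not_Minus[of 1 "\<lfloor>z\<rfloor> - 1"] by (auto simp: z_def[symmetric])
  ultimately show ?thesis
    unfolding z_def[symmetric] by (intro exI[of _ "\<lfloor>z\<rfloor>"]) linarith
qed

text \<open>To be used with \<open>r = 0\<close> for points inside \<open>I_+\<close> and with \<open>r = 1/2\<close> for points inside \<open>I_-\<close>.\<close>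

lemma to_circle_inside:
  assumes "of_int k + r < y" "y < of_int k + r + 1/2"
  shows "to_circle y \<noteq> to_circle r" "to_circle y \<noteq> to_circle (r + 1/2)"
    "1/2 \<le> s - r \<Longrightarrow> s - r \<le> 1 \<Longrightarrow> to_circle y \<noteq> to_circle s"
proof -
  show *: "to_circle y \<noteq> to_circle s" if "1/2 \<le> s - r" "s - r \<le> 1" for s
  proof
    assume "to_circle y = to_circle s"
    then obtain l where "y - s = of_int l" by (auto simp: to_circle_eq_iff elim: Ints_cases)
    then have "of_int (k - 1) < (of_int l :: real)" "(of_int l :: real) < of_int k"
      using assms that by simp_all
    then show False unfolding of_int_less_iff by linarith
  qed
  show "to_circle y \<noteq> to_circle (r + 1/2)" by (rule *) auto
  have "to_circle (r + 1) = to_circle r" by (simp add: to_circle_eq_iff)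
  then show "to_circle y \<noteq> to_circle r" using *[of "r + 1"] by simp
qed

text \<open>At \<open>b = 1\<close> the whole interval \<open>[1/2, 1]\<close> is mapped by \<open>F a 1 ^^ p\<close> to the image of \<open>1/2\<close>, so this
  image, moved back by \<open>m\<close>, is a superattracting point as soon as it lies inside the interval; the
  level condition says that it does.\<close>

lemma superattracting_in_itinerary_params:
  assumes p: "0 < p"
    and exact: "\<And>j. 0 < j \<Longrightarrow> j < p \<Longrightarrow> (2 ^ j - 1) * (of_int m / (2 ^ p - 1)) \<notin> (\<int> :: real set)"
    and level: "of_int m < level p a 1" "level p a 1 < of_int m + 1/2"
  shows "(to_circle a, 1) \<in> itinerary_params (itinerary p)"
proof -
  define x where "x = (F a 1 ^^ p) (1/2) - of_int m"
  define f where "f = fmap (to_circle a) 1"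
  have x: "1/2 < x" "x < 1" using level by (simp_all add: x_def level_def)
  have flat: "(F a 1 ^^ p) y = x + of_int m" if "1/2 \<le> y" "y \<le> 1" for y
    using funpow_F_flat[of y "1/2" p a] p that by (simp add: x_def)
  have orbit: "\<exists>k::int. of_int k < (F a 1 ^^ j) x \<and> (F a 1 ^^ j) x < of_int k + 1/2" if "0 < j" "j < p" for j
    using superattracting_orbit_Plus[OF p x flat that exact[OF that]] x by simp
  have f: "(f ^^ n) (to_circle y) = to_circle ((F a 1 ^^ n) y)" for n y
    by (simp add: f_def funpow_fmap_to_circle)
  have const: "(f ^^ p) y = to_circle x" if "y \<in> to_circle ` {1/2<..<1}" for y
    using that flat by (auto simp: f to_circle_add_int)
  have period: "exact_period f p (to_circle x)"
    unfolding exact_period_def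
  proof (intro conjI allI impI p)
    show "(f ^^ p) (to_circle x) = to_circle x" using const x by simp
    fix j assume j: "0 < j \<and> j < p"
    then obtain k :: int where "of_int k < (F a 1 ^^ j) x" "(F a 1 ^^ j) x < of_int k + 1/2"
      using orbit by blast
    then show "(f ^^ j) (to_circle x) \<noteq> to_circle x"
      using to_circle_inside(3)[of k 0 "(F a 1 ^^ j) x" x] x by (simp add: f)
  qed
  have "attracting_cycle f p (to_circle x)"
    using x const open_vimage_funpow_fmap[where \<alpha> = "to_circle a" and b = 1]
    by (intro attracting_cycle_if_locally_constant[where V = "to_circle ` {1/2<..<1}"] period
        open_to_circle_image) (auto simp: f_def)
  moreover have "has_itinerary f (to_circle x) (itinerary p)"
    unfolding has_itinerary_def length_itinerary[OF p]
  proof (intro conjI allI impI period)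
    fix j assume j: "j < p"
    have "(f ^^ j) (to_circle x) \<notin> {to_circle 0, to_circle (1/2)}
        \<and> (f ^^ j) (to_circle x) \<in> slope_interval (itinerary p ! j)"
    proof (cases "j = 0")
      case True
      have "to_circle 1 = to_circle 0" by (simp add: to_circle_eq_iff)
      then show ?thesis
        using to_circle_inside(1,2)[of 0 "1/2" x] x True p by (auto simp: itinerary_nth)
    next
      case False
      then obtain k :: int where k: "of_int k < (F a 1 ^^ j) x" "(F a 1 ^^ j) x < of_int k + 1/2"
        using orbit j by blast
      have "to_circle ((F a 1 ^^ j) x) = to_circle ((F a 1 ^^ j) x - of_int k)"
        by (simp add: to_circle_eq_iff)
      then have "to_circle ((F a 1 ^^ j) x) \<in> slope_interval Plus" using k by auto
      then show ?thesis
        using to_circle_inside(1,2)[of k 0 "(F a 1 ^^ j) x"] k False j by (simp add: itinerary_nth f)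
    qed
    then show "(f ^^ j) (to_circle x) \<notin> {to_circle 0, to_circle (1/2)}"
      "(f ^^ j) (to_circle x) \<in> slope_interval (itinerary p ! j)" by auto
  qed
  ultimately show ?thesis
    unfolding itinerary_params_def f_def using length_itinerary[OF p] by auto
qed

lemma level_param_diff:
  assumes "a \<le> a'" "0 < p"
  shows "a' - a \<le> level p a' 1 - level p a 1"
  using funpow_F_param_diff[of 1 a a' p "1/2"] assms by (simp add: level_def)

lemma level_surj:
  assumes "0 < p"
  obtains a where "level p a 1 = y"
proof -
  define M where "M = \<bar>y - level p 0 1\<bar>"
  have "continuous_on UNIV ((\<lambda>(a, b). level p a b) \<circ> (\<lambda>a. (a, 1)))"
    using continuous_on_level[of p]
    by (intro continuous_on_compose continuous_intros) (auto intro: continuous_on_subset)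
  then have "continuous_on {-M..M} (\<lambda>a. level p a 1)"
    by (auto simp: o_def intro: continuous_on_subset)
  moreover have "level p (-M) 1 \<le> y" "y \<le> level p M 1"
    using level_param_diff[OF _ assms, of 0 M] level_param_diff[OF _ assms, of "-M" 0]
    by (auto simp: M_def)
  ultimately show ?thesis
    using IVT'[of "\<lambda>a. level p a 1" "-M" y M] that by (auto simp: M_def)
qed

section \<open>The tongue of a given type\<close>

theorem theorem4p12:
  fixes \<tau> :: circle
  assumes "\<exists>n>0. (doubling ^^ n) \<tau> = \<tau>"
  shows "\<exists>S. tongue S \<and> (\<forall>(a, b)\<in>S. has_type a b \<tau>)"
proof -
  define p where "p = (LEAST n. 0 < n \<and> (doubling ^^ n) \<tau> = \<tau>)"
  have p: "0 < p" and per: "(doubling ^^ p) \<tau> = \<tau>"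
    using LeastI_ex[OF assms] by (auto simp: p_def)
  have min: "(doubling ^^ j) \<tau> \<noteq> \<tau>" if "0 < j" "j < p" for j
    using not_less_Least[of j "\<lambda>n. 0 < n \<and> (doubling ^^ n) \<tau> = \<tau>"] that by (auto simp: p_def)
  obtain t where t: "\<tau> = to_circle t" by (rule circle_cases)
  have doubling: "(doubling ^^ j) \<tau> = to_circle (2 ^ j * t)" for j
    by (induction j) (simp_all add: t doubling.abs_eq mult.assoc)
  obtain m where "2 ^ p * t - t = of_int m"
    using per unfolding doubling unfolding t to_circle_eq_iff by (rule Ints_cases)
  moreover have "(2::real) ^ p - 1 \<noteq> 0" using p by (rule two_power_minus_1_nonzero)
  ultimately have t_eq: "t = of_int m / (2 ^ p - 1)" by (simp add: field_simps)
  have exact: "(2 ^ j - 1) * (of_int m / (2 ^ p - 1)) \<notin> (\<int> :: real set)" if "0 < j" "j < p" for j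
    using min[OF that] unfolding doubling unfolding t to_circle_eq_iff t_eq[symmetric]
    by (simp add: left_diff_distrib)

  \<comment> \<open>The two bands separate type \<open>\<tau>\<close> from all other types.\<close>
  define K where "K = band p (residue_class p m)"
  define K' where "K' = band p (- residue_class p m)"
  have res: "k + (2 ^ p - 1) * j \<in> residue_class p m \<longleftrightarrow> k \<in> residue_class p m" for k j
    by (rule residue_class_add)
  have closed: "closed K" "closed K'" and disjoint: "K \<inter> K' = {}"
    unfolding K_def K'_def using res
    by (auto intro!: closed_band band_disjoint)

  obtain c where c: "level p c 1 = of_int m" using level_surj[OF p] by blast
  obtain d where d: "level p d 1 = of_int m + 1/2" using level_surj[OF p] by blast
  have "c < d" using level_param_diff[of d c p] p c d by linarith
  moreover have "d < c + 1" using level_param_diff[of c d p] p c d \<open>c < d\<close> by linarith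
  define P where "P = itinerary_params (itinerary p)"
  define g where "g = (\<lambda>a. (to_circle a, 1 :: real))"
  have g: "continuous_on X g" for X
    unfolding g_def using continuous_on_to_circle
    by (intro continuous_intros) (auto intro: continuous_on_subset)
  have arc: "g ` {c<..<d} \<subseteq> P"
  proof
    fix z assume "z \<in> g ` {c<..<d}"
    then obtain a where a: "z = (to_circle a, 1)" "c < a" "a < d" by (auto simp: g_def)
    have "of_int m < level p a 1" "level p a 1 < of_int m + 1/2"
      using level_param_diff[of c a p] level_param_diff[of a d p] a p c d by linarith+
    then show "z \<in> P"
      using superattracting_in_itinerary_params[OF p exact] by (simp add: a(1) P_def)
  qed
  define s where "s = g ((c + d) / 2)"
  have s: "s \<in> g ` {c<..<d}" unfolding s_def using \<open>c < d\<close> by (intro imageI) auto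
  define S where "S = connected_component_set P s"
  have "S \<in> components P" using s arc by (auto simp: S_def components_def)
  have "S \<subseteq> P" by (simp add: S_def connected_component_subset)
  have arc_S: "g ` {c<..<d} \<subseteq> S"
    unfolding S_def using s arc by (intro connected_component_maximal connected_continuous_image g) auto

  have "g ` {c<..<d} \<subseteq> K"
  proof
    fix z assume "z \<in> g ` {c<..<d}"
    then obtain a where a: "z = (to_circle a, 1)" "c < a" "a < d" by (auto simp: g_def)
    have "m \<in> residue_class p m" by (simp add: residue_class_def)
    moreover have "level p a 1 \<in> {of_int m..of_int m + 1/2}"
      using level_param_diff[of c a p] level_param_diff[of a d p] a p c d by auto
    ultimately show "z \<in> K" unfolding a(1) K_def using band_iff[OF res] by blast
  qed
  with s arc_S have "S \<inter> K \<noteq> {}" by auto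
  have "S \<subseteq> K"
  proof -
    have "S \<subseteq> K \<union> K'"
      using \<open>S \<subseteq> P\<close> itinerary_params_subset_bands[OF p] by (auto simp: P_def K_def K'_def)
    moreover have "connected S" by (simp add: S_def connected_connected_component)
    ultimately have "S \<inter> K' = {}"
      using \<open>S \<inter> K \<noteq> {}\<close> closed disjoint connected_closedD[of S K K'] by blast
    with \<open>S \<subseteq> K \<union> K'\<close> show ?thesis by blast
  qed

  have "closure S \<inter> (UNIV \<times> {1}) = to_circle ` {c..d} \<times> {1}"
  proof (intro equalityI subsetI)
    fix z assume z: "z \<in> closure S \<inter> (UNIV \<times> {1})"
    then obtain a where a: "z = (to_circle a, 1)" by (metis IntD2 SigmaE circle_cases singletonD)
    have "z \<in> K" using z \<open>S \<subseteq> K\<close> closed(1) closure_minimal by blast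
    then obtain k where k: "k \<in> residue_class p m" "level p a 1 \<in> {of_int k..of_int k + 1/2}"
      unfolding a K_def using band_iff[OF res] by blast
    then obtain j where "k - m = (2 ^ p - 1) * j" by (auto simp: residue_class_def)
    then have j: "k = m + (2 ^ p - 1) * j" by simp
    \<comment> \<open>Another lift of the same point moves the level into the interval belonging to \<open>m\<close> itself.\<close>
    define a' where "a' = a + of_int (- j)"
    have "level p a' 1 = level p a 1 + of_int ((2 ^ p - 1) * (- j))"
      unfolding a'_def by (rule level_add_int)
    with k(2) have a': "level p a' 1 \<in> {of_int m..of_int m + 1/2}" by (simp add: j)
    have "c \<le> a'"
    proof (rule ccontr)
      assume "\<not> c \<le> a'"
      then show False using level_param_diff[of a' c p] p c a' by simp
    qed
    moreover have "a' \<le> d"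
    proof (rule ccontr)
      assume "\<not> a' \<le> d"
      then show False using level_param_diff[of d a' p] p d a' by simp
    qed
    ultimately have "a' \<in> {c..d}" by simp
    moreover have "to_circle a = to_circle a'" by (simp add: a'_def to_circle_eq_iff)
    ultimately show "z \<in> to_circle ` {c..d} \<times> {1}" by (auto simp: a)
  next
    fix z :: "circle \<times> real" assume "z \<in> to_circle ` {c..d} \<times> {1}"
    then have "z \<in> g ` closure {c<..<d}" using \<open>c < d\<close> by (auto simp: g_def)
    moreover have "g ` closure {c<..<d} \<subseteq> closure S"
      using arc_S closure_subset by (intro image_closure_subset g) auto
    ultimately show "z \<in> closure S \<inter> (UNIV \<times> {1})" by (auto simp: g_def)
  qed
  then have "tongue S"
    unfolding tongue_def using \<open>S \<in> components P\<close> \<open>c < d\<close> \<open>d < c + 1\<close> unfolding P_def by blast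
  moreover have "has_type \<alpha> b \<tau>" if "(\<alpha>, b) \<in> S" for \<alpha> b
    using that \<open>S \<subseteq> P\<close> \<open>S \<subseteq> K\<close> has_type_band[OF p] unfolding t t_eq P_def K_def by blast
  ultimately show ?thesis by blast
qed

end
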